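(* (1) Consider a self-improving algorithm that, given any fixed distribution $\mathcal{D}$ on inputs $I=(x_1,\dots,x_n)\in\mathbb{R}^n$ (not necessarily of product type), can sort a random input from $\mathcal{D}$ in expected $O(n+H(\pi(I)))$ time. Such an algorithm requires $2^{\Omega(n\log n)}$ bits of storage. (2) Let $\varepsilon\in(0,1)$. Consider a self-improving algorithm that, given any product distribution $\mathcal{D}=\prod_i\mathcal{D}_i$, can sort a random input from $\mathcal{D}$ in expected $\varepsilon^{-1}(n+H(\pi(I)))$ time. Such an algorithm requires a data structure of bit size $n^{1+\Omega(\varepsilon)}$.
   Context: $\pi(I)$ is the permutation induced by the ranks of the entries of $I$, with ties broken by index. $H$ denotes Shannon entropy, taken over $I\sim\mathcal{D}$. A product distribution $\mathcal{D}=\prod_i\mathcal{D}_i$ is one in which each $x_i$ is drawn independently from its own distribution $\mathcal{D}_i$. Algorithms are comparison-based. A comparison-based algorithm is a binary decision tree whose internal nodes test $f(I)\le g(I)$ for arbitrary real-valued functions $f,g$ and whose leaves give the output. The storage is the information the algorithm retains about $\mathcal{D}$; it determines the comparison tree that the algorithm uses to sort inputs from $\mathcal{D}$. *)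

theory Defs
  imports "HOL-Probability.Probability"
begin

text \<open>Inputs of length \<open>n\<close> are points of the product Borel space over the index set
  \<open>{..<n}\<close>, i.e. functions on \<open>nat\<close> that are \<open>undefined\<close> outside \<open>{..<n}\<close>.\<close>

type_synonym input = "nat \<Rightarrow> real"

definition input_dists :: "nat \<Rightarrow> input measure set" where
  "input_dists n = {D. prob_space D \<and> sets D = sets (\<Pi>\<^sub>M i\<in>{..<n}. (borel :: real measure))}"

definition product_dists :: "nat \<Rightarrow> input measure set" where
  "product_dists n =
     {(\<Pi>\<^sub>M i\<in>{..<n}. P i) | P :: nat \<Rightarrow> real measure.
        \<forall>i<n. prob_space (P i) \<and> sets (P i) = sets borel}"

text \<open>Ranks count from \<open>0\<close>; \<open>rank_perm n x\<close> is the identity outside \<open>{..<n}\<close>, as required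
  by \<open>permutes\<close>.\<close>

definition rank_perm :: "nat \<Rightarrow> input \<Rightarrow> nat \<Rightarrow> nat" where
  "rank_perm n x i =
     (if i < n then card {j\<in>{..<n}. x j < x i \<or> (x j = x i \<and> j < i)} else i)"

definition perm_entropy :: "nat \<Rightarrow> input measure \<Rightarrow> real" where
  "perm_entropy n D =
     prob_space.entropy D 2 (count_space (rank_perm n ` space D)) (rank_perm n)"

text \<open>In \<open>Node f g l r\<close> the test is \<open>f x \<le> g x\<close>, with \<open>l\<close> the branch taken when it holds.
  A leaf holds the indices of the entries of the input, listed in sorted order.\<close>

datatype ctree =
    Leaf "nat \<Rightarrow> nat"
  | Node "input \<Rightarrow> real" "input \<Rightarrow> real" ctree ctree

fun result :: "ctree \<Rightarrow> input \<Rightarrow> nat \<Rightarrow> nat" where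
  "result (Leaf \<sigma>) x = \<sigma>"
| "result (Node f g l r) x = (if f x \<le> g x then result l x else result r x)"

fun comparisons :: "ctree \<Rightarrow> input \<Rightarrow> nat" where
  "comparisons (Leaf \<sigma>) x = 0"
| "comparisons (Node f g l r) x =
     Suc (if f x \<le> g x then comparisons l x else comparisons r x)"

definition sorting_perm :: "nat \<Rightarrow> input \<Rightarrow> (nat \<Rightarrow> nat) \<Rightarrow> bool" where
  "sorting_perm n x \<sigma> \<longleftrightarrow>
     \<sigma> permutes {..<n} \<and> (\<forall>i j. i \<le> j \<and> j < n \<longrightarrow> x (\<sigma> i) \<le> x (\<sigma> j))"

text \<open>The tests are arbitrary functions, so the number of comparisons need not be measurable;
  \<open>nn_integral\<close> is then the lower integral, and agrees with the expectation whenever the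
  latter exists.\<close>

definition sorts_within :: "nat \<Rightarrow> input measure \<Rightarrow> ctree \<Rightarrow> real \<Rightarrow> bool" where
  "sorts_within n D t T \<longleftrightarrow>
     (AE x in D. sorting_perm n x (result t x)) \<and>
     (\<integral>\<^sup>+ x. of_nat (comparisons t x) \<partial>D) \<le> ennreal T"

text \<open>\<open>stored A n D\<close> is the bit string that the algorithm retains about the distribution \<open>D\<close>
  of inputs of length \<open>n\<close>. The tree used for sorting is a function of \<open>n\<close> and of that
  string only.\<close>

record self_improving_alg =
  stored :: "nat \<Rightarrow> input measure \<Rightarrow> bool list"
  tree_of :: "nat \<Rightarrow> bool list \<Rightarrow> ctree"

definition self_improving_sorter ::
    "self_improving_alg \<Rightarrow> (nat \<Rightarrow> input measure set) \<Rightarrow> real \<Rightarrow> bool" where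
  "self_improving_sorter A \<D> c \<longleftrightarrow>
     (\<forall>n\<ge>1. \<forall>D\<in>\<D> n.
        sorts_within n D (tree_of A n (stored A n D)) (c * (real n + perm_entropy n D)))"

text \<open>Storage is measured in the worst case over the admissible distributions.\<close>

definition requires_storage ::
    "self_improving_alg \<Rightarrow> (nat \<Rightarrow> input measure set) \<Rightarrow> nat \<Rightarrow> real \<Rightarrow> bool" where
  "requires_storage A \<D> n s \<longleftrightarrow> (\<exists>D\<in>\<D> n. s \<le> real (length (stored A n D)))"

end

theory Submission
  imports Defs
begin

text \<open>Counting argument. Among the \<open>n ^ n\<close> inputs with entries in \<open>{0, ..., n - 1}\<close>, at most
  \<open>4 ^ n\<close> are sorted by one permutation, so Kraft's inequality bounds the sum of
  \<open>2 ^ (- comparisons)\<close> over all inputs that a fixed tree sorts by \<open>4 ^ n\<close>. Consequently a tree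
  that sorts the members of a family of \<open>m\<close> such inputs with \<open>T\<close> comparisons in total is shared
  by at most \<open>4 ^ (n m) 2 ^ T\<close> of the \<open>n ^ (n m)\<close> families.

  For (1), the distribution is uniform on a family of \<open>m = 2 ^ (\<delta> n log n)\<close> inputs: its entropy
  is at most \<open>log m\<close>, hence \<open>T = c m (n + log m)\<close> is less than a constant fraction of
  \<open>m n log n\<close>, and about \<open>m n log n\<close> bits are needed to tell the families apart. For (2), the
  coordinates are independent, each uniform on \<open>k = n ^ (\<epsilon> / 4)\<close> values given by the rows of a
  \<open>k \<times> n\<close> matrix; the entropy is at most \<open>n log k\<close>, and the count is the same because some
  \<open>k\<close> inputs of at most average cost together contain all entries of the matrix.\<close>

section \<open>Grid inputs and Kraft's inequality\<close>

definition grid :: "nat \<Rightarrow> input set" where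
  "grid n = ({..<n} \<rightarrow>\<^sub>E real ` {..<n})"

lemma finite_grid [simp]: "finite (grid n)"
  by (simp add: grid_def finite_PiE)

lemma card_grid: "card (grid n) = n ^ n"
  by (simp add: grid_def card_PiE card_image)

text \<open>Adding \<open>i\<close> to the \<open>i\<close>-th smallest entry makes the sorted sequence strictly
  increasing, so that it is determined by its set of values.\<close>

lemma card_grid_sorted_by_le:
  "card {x \<in> grid n. sorting_perm n x \<sigma>} \<le> 4 ^ n"
proof -
  let ?W = "{x \<in> grid n. sorting_perm n x \<sigma>}"
  let ?l = "\<lambda>x. map (\<lambda>i. x (\<sigma> i) + real i) [0..<n]"
  have sorted: "sorted_wrt (<) (?l x)" if "x \<in> ?W" for x
    using that by (force simp: sorted_wrt_iff_nth_less sorting_perm_def intro: add_le_less_mono)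
  have inj: "inj_on (\<lambda>x. set (?l x)) ?W"
  proof (rule inj_onI)
    fix x y assume x: "x \<in> ?W" and y: "y \<in> ?W" and eq: "set (?l x) = set (?l y)"
    have "?l x = ?l y"
      using sorted[OF x] sorted[OF y] eq by (intro strict_sorted_equal) auto
    hence *: "x (\<sigma> i) = y (\<sigma> i)" if "i < n" for i
      using that by simp
    have perm: "\<sigma> permutes {..<n}"
      using x by (simp add: sorting_perm_def)
    show "x = y"
    proof (rule PiE_ext)
      show "x \<in> {..<n} \<rightarrow>\<^sub>E real ` {..<n}" "y \<in> {..<n} \<rightarrow>\<^sub>E real ` {..<n}"
        using x y by (auto simp: grid_def)
      fix j assume "j \<in> {..<n}"
      then obtain i where "i < n" "j = \<sigma> i"
        using permutes_image[OF perm] by (metis imageE lessThan_iff)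
      thus "x j = y j"
        using * by simp
    qed
  qed
  \<comment> \<open>Both \<open>x (\<sigma> i)\<close> and the shift \<open>i\<close> are below
    \<open>n\<close>, so all values lie among \<open>2 * n\<close> numbers; \<open>4 ^ n\<close>
    counts their subsets.\<close>
  have sub: "(\<lambda>x. set (?l x)) ` ?W \<subseteq> Pow (real ` {..<2 * n})"
  proof safe
    fix x z assume x: "x \<in> grid n" "sorting_perm n x \<sigma>" and z: "z \<in> set (?l x)"
    then obtain i where i: "i < n" "z = x (\<sigma> i) + real i"
      by auto
    have "\<sigma> i < n"
      using permutes_in_image[of \<sigma> "{..<n}" i] x i by (simp add: sorting_perm_def)
    hence "x (\<sigma> i) \<in> real ` {..<n}"
      using x(1) by (auto simp: grid_def PiE_iff)
    then obtain m where "m < n" "x (\<sigma> i) = real m"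
      by auto
    thus "z \<in> real ` {..<2 * n}"
      using i by (auto intro!: image_eqI[of _ _ "m + i"])
  qed
  have "card ?W \<le> card (Pow (real ` {..<2 * n}))"
    by (rule card_inj_on_le[OF inj sub]) simp
  also have "\<dots> = 4 ^ n"
    by (simp add: card_Pow card_image power_mult)
  finally show ?thesis .
qed

text \<open>Induction on the tree. A leaf outputs one permutation and so serves at most
  \<open>4 ^ n\<close> grid inputs, each of weight 1. A test splits \<open>W\<close> in two and
  halves every weight, which leaves the average of two sums bounded by \<open>4 ^ n\<close>.\<close>

lemma kraft_sum_le:
  assumes "W \<subseteq> grid n" "\<And>x. x \<in> W \<Longrightarrow> sorting_perm n x (result t x)"
  shows "(\<Sum>x\<in>W. (1/2::real) ^ comparisons t x) \<le> 4 ^ n"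
  using assms
proof (induction t arbitrary: W)
  case (Leaf \<sigma>)
  hence "card W \<le> card {x \<in> grid n. sorting_perm n x \<sigma>}"
    by (intro card_mono) auto
  also note card_grid_sorted_by_le
  finally have "real (card W) \<le> real (4 ^ n)"
    by (rule of_nat_mono)
  thus ?case by simp
next
  case (Node f g l r)
  let ?L = "{x \<in> W. f x \<le> g x}" and ?R = "{x \<in> W. \<not> f x \<le> g x}"
  have fin: "finite W"
    using Node.prems(1) finite_grid finite_subset by blast
  have "(\<Sum>x\<in>W. (1/2::real) ^ comparisons (Node f g l r) x)
      = (\<Sum>x\<in>?L \<union> ?R. (1/2::real) ^ comparisons (Node f g l r) x)"
    by (rule sum.cong) auto
  also have "\<dots> = (\<Sum>x\<in>?L. (1/2::real) ^ comparisons (Node f g l r) x)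
      + (\<Sum>x\<in>?R. (1/2::real) ^ comparisons (Node f g l r) x)"
    using fin by (intro sum.union_disjoint) auto
  also have "\<dots> = 1/2 * (\<Sum>x\<in>?L. (1/2::real) ^ comparisons l x)
      + 1/2 * (\<Sum>x\<in>?R. (1/2::real) ^ comparisons r x)"
    by (simp add: sum_distrib_left)
  also have "(\<Sum>x\<in>?L. (1/2::real) ^ comparisons l x) \<le> 4 ^ n"
    using Node.prems by (intro Node.IH(1)) force+
  also have "(\<Sum>x\<in>?R. (1/2::real) ^ comparisons r x) \<le> 4 ^ n"
    using Node.prems by (intro Node.IH(2)) force+
  finally show ?case by simp
qed

section \<open>Families sorted by one tree\<close>

definition sorted_family :: "nat \<Rightarrow> ctree \<Rightarrow> 'j set \<Rightarrow> ('j \<Rightarrow> input) \<Rightarrow> real \<Rightarrow> bool" where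
  "sorted_family n t J \<phi> T \<longleftrightarrow>
     (\<forall>j\<in>J. sorting_perm n (\<phi> j) (result t (\<phi> j))) \<and>
     (\<Sum>j\<in>J. real (comparisons t (\<phi> j))) \<le> T"

text \<open>A family of total cost at most \<open>T\<close> has a product of Kraft weights of at
  least \<open>2 powr (-T)\<close>. Summed over all families of correctly sorted inputs, these
  products factor into \<open>card J\<close> Kraft sums.\<close>

lemma card_sorted_families_le:
  fixes J :: "'j set"
  assumes "finite J"
  shows "real (card {f \<in> J \<rightarrow>\<^sub>E grid n. sorted_family n t J f T}) \<le> 4 ^ (n * card J) * 2 powr T"
proof -
  let ?F = "{f \<in> J \<rightarrow>\<^sub>E grid n. sorted_family n t J f T}"
  let ?W = "{x \<in> grid n. sorting_perm n x (result t x)}"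
  have "2 powr (-T) * real (card ?F) = (\<Sum>f\<in>?F. 2 powr (-T))"
    by simp
  also have "\<dots> \<le> (\<Sum>f\<in>?F. \<Prod>j\<in>J. (1/2::real) ^ comparisons t (f j))"
  proof (rule sum_mono)
    fix f assume "f \<in> ?F"
    hence "2 powr (-T) \<le> (2::real) powr (- (\<Sum>j\<in>J. real (comparisons t (f j))))"
      by (simp add: sorted_family_def)
    also have "\<dots> = (\<Prod>j\<in>J. (1/2::real) ^ comparisons t (f j))"
      by (simp add: powr_sum powr_minus powr_realpow power_one_over inverse_eq_divide flip: sum_negf)
    finally show "2 powr (-T) \<le> (\<Prod>j\<in>J. (1/2::real) ^ comparisons t (f j))" .
  qed
  also have "\<dots> \<le> (\<Sum>f\<in>J \<rightarrow>\<^sub>E ?W. \<Prod>j\<in>J. (1/2::real) ^ comparisons t (f j))"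
    using assms by (intro sum_mono2 finite_PiE)
      (auto simp: sorted_family_def PiE_def intro!: prod_nonneg)
  also have "\<dots> = (\<Prod>j\<in>J. \<Sum>x\<in>?W. (1/2::real) ^ comparisons t x)"
    using assms by (subst prod_sum_PiE) auto
  also have "\<dots> \<le> (\<Prod>j\<in>J. 4 ^ n)"
    by (intro prod_mono conjI kraft_sum_le sum_nonneg) auto
  finally have "real (card ?F) / 2 powr T \<le> 4 ^ (n * card J)"
    by (simp add: powr_minus_divide power_mult)
  thus ?thesis
    by (simp add: pos_divide_le_eq)
qed

section \<open>Mixtures of rows and cyclic shifts\<close>

text \<open>The rows of \<open>f\<close> are the input vectors; an input from the product distribution mixes
  coordinates of different rows. Cyclic shifts split the \<open>k ^ n\<close> mixtures into classes of \<open>k\<close>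
  that use every coordinate of every row once, so that a single class determines \<open>f\<close>.\<close>

definition mix :: "nat \<Rightarrow> (nat \<Rightarrow> input) \<Rightarrow> (nat \<Rightarrow> nat) \<Rightarrow> input" where
  "mix n f a = (\<lambda>i\<in>{..<n}. f (a i) i)"

definition cyclic_shift :: "nat \<Rightarrow> nat \<Rightarrow> nat \<Rightarrow> (nat \<Rightarrow> nat) \<Rightarrow> nat \<Rightarrow> nat" where
  "cyclic_shift n k r a = (\<lambda>i\<in>{..<n}. (a i + r) mod k)"

lemma cyclic_shift_in:
  "0 < k \<Longrightarrow> cyclic_shift n k r a \<in> {..<n} \<rightarrow>\<^sub>E {..<k}"
  by (auto simp: cyclic_shift_def)

lemma sum_cyclic_shift:
  fixes G :: "(nat \<Rightarrow> nat) \<Rightarrow> real"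
  assumes "r < k"
  shows "(\<Sum>a\<in>{..<n} \<rightarrow>\<^sub>E {..<k}. G (cyclic_shift n k r a)) = (\<Sum>a\<in>{..<n} \<rightarrow>\<^sub>E {..<k}. G a)"
proof (rule sum.reindex_bij_witness[where i = "cyclic_shift n k (k - r)" and j = "cyclic_shift n k r"])
  have inv: "cyclic_shift n k s (cyclic_shift n k r' a) = a"
    if "a \<in> {..<n} \<rightarrow>\<^sub>E {..<k}" "r' + s = k" for a r' s
  proof
    fix i
    show "cyclic_shift n k s (cyclic_shift n k r' a) i = a i"
    proof (cases "i < n")
      case True
      hence "a i < k" using PiE_mem[OF that(1), of i] by simp
      moreover have "((a i + r') mod k + s) mod k = (a i + (r' + s)) mod k"
        by (simp add: mod_add_left_eq add.assoc)
      ultimately show ?thesis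
        using True that(2) by (simp add: cyclic_shift_def)
    next
      case False
      thus ?thesis using PiE_arb[OF that(1), of i] by (simp add: cyclic_shift_def)
    qed
  qed
  show "cyclic_shift n k (k - r) (cyclic_shift n k r a) = a" if "a \<in> {..<n} \<rightarrow>\<^sub>E {..<k}" for a
    by (rule inv[OF that]) (use assms in simp)
  show "cyclic_shift n k r (cyclic_shift n k (k - r) a) = a" if "a \<in> {..<n} \<rightarrow>\<^sub>E {..<k}" for a
    by (rule inv[OF that]) (use assms in simp)
qed (use assms in \<open>auto simp: cyclic_shift_in\<close>)

lemma mix_in_grid:
  assumes "f \<in> {..<k} \<rightarrow>\<^sub>E grid n" "a \<in> {..<n} \<rightarrow>\<^sub>E {..<k}"
  shows "mix n f a \<in> grid n"
  unfolding grid_def mix_def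
proof (rule restrict_PiE_iff[THEN iffD2], rule ballI)
  fix i assume "i \<in> {..<n}"
  thus "f (a i) i \<in> real ` {..<n}"
    using assms PiE_mem[of a "{..<n}" "\<lambda>_. {..<k}" i] PiE_mem[of f "{..<k}" "\<lambda>_. grid n" "a i"]
    by (auto simp: grid_def PiE_iff)
qed

text \<open>The entry \<open>f s i\<close> sits at position \<open>i\<close> of the mixture whose
  shift \<open>r\<close> satisfies \<open>a i + r = s\<close> modulo \<open>k\<close>.\<close>

lemma inj_on_mix_cyclic_shift:
  assumes "0 < k"
  shows "inj_on (\<lambda>f. \<lambda>r\<in>{..<k}. mix n f (cyclic_shift n k r a)) ({..<k} \<rightarrow>\<^sub>E grid n)"
proof (rule inj_onI)
  fix f g assume f: "f \<in> {..<k} \<rightarrow>\<^sub>E grid n" and g: "g \<in> {..<k} \<rightarrow>\<^sub>E grid n"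
    and eq: "(\<lambda>r\<in>{..<k}. mix n f (cyclic_shift n k r a)) = (\<lambda>r\<in>{..<k}. mix n g (cyclic_shift n k r a))"
  show "f = g"
  proof (rule PiE_ext[OF f g])
    fix s assume s: "s \<in> {..<k}"
    have fs: "f s \<in> grid n" "g s \<in> grid n"
      using f g s by auto
    show "f s = g s"
    proof (rule PiE_ext[OF fs[unfolded grid_def]])
      fix i assume i: "i \<in> {..<n}"
      \<comment> \<open>Subtracting \<open>a i mod k\<close> from \<open>k\<close> avoids truncation
        on \<open>nat\<close>; the extra \<open>k\<close> vanishes modulo \<open>k\<close>.\<close>
      define r where "r = (s + (k - a i mod k)) mod k"
      have "(a i + r) mod k = (a i mod k + (s + (k - a i mod k))) mod k"
        unfolding r_def by (metis mod_add_left_eq mod_add_right_eq)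
      also have "a i mod k + (s + (k - a i mod k)) = s + k"
        using mod_less_divisor[OF assms, of "a i"] by linarith
      finally have "(a i + r) mod k = s"
        using s by simp
      moreover have "r < k"
        using assms by (simp add: r_def)
      ultimately show "f s i = g s i"
        using fun_cong[OF fun_cong[OF eq, of r], of i] i by (simp add: mix_def cyclic_shift_def)
    qed
  qed
qed

text \<open>Averaging over \<open>a\<close> finds a class of \<open>k\<close> shifts sorted with at
  most \<open>k * T\<close> comparisons in total. It determines \<open>f\<close>, and the count for
  families applies to it; the factor \<open>real k ^ n\<close> is a union bound over
  \<open>a\<close>.\<close>

lemma card_sorted_mixtures_le:
  assumes k: "0 < k"
  shows "real (card {f \<in> {..<k} \<rightarrow>\<^sub>E grid n.
            sorted_family n t ({..<n} \<rightarrow>\<^sub>E {..<k}) (mix n f) (real k ^ n * T)})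
      \<le> real k ^ n * (4 ^ (n * k) * 2 powr (k * T))"
proof -
  let ?A = "{..<n} \<rightarrow>\<^sub>E {..<k}"
  let ?F = "{f \<in> {..<k} \<rightarrow>\<^sub>E grid n. sorted_family n t ?A (mix n f) (real k ^ n * T)}"
  let ?h = "\<lambda>a f. \<lambda>r\<in>{..<k}. mix n f (cyclic_shift n k r a)"
  let ?S = "{f \<in> {..<k} \<rightarrow>\<^sub>E grid n. sorted_family n t {..<k} f (k * T)}"
  have finA: "finite ?A" and cardA: "card ?A = k ^ n"
    by (auto simp: finite_PiE card_PiE)
  have finF: "finite ({..<k} \<rightarrow>\<^sub>E grid n)"
    by (simp add: finite_PiE)
  have ex: "\<exists>a\<in>?A. ?h a f \<in> ?S" if f: "f \<in> ?F" for f
  proof -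
    define C where "C b = real (comparisons t (mix n f b))" for b
    \<comment> \<open>Each shift permutes the index vectors, so every mixture is counted exactly
      \<open>k\<close> times.\<close>
    have "(\<Sum>a\<in>?A. \<Sum>r<k. C (cyclic_shift n k r a)) = (\<Sum>r<k. \<Sum>a\<in>?A. C (cyclic_shift n k r a))"
      by (rule sum.swap)
    also have "\<dots> = (\<Sum>r<k. \<Sum>a\<in>?A. C a)"
      by (rule sum.cong[OF refl], rule sum_cyclic_shift) simp
    also have "\<dots> \<le> k * (real k ^ n * T)"
      using f k by (simp add: C_def sorted_family_def)
    also have "\<dots> = (\<Sum>a\<in>?A. k * T)"
      by (simp add: cardA)
    finally have "(\<Sum>a\<in>?A. \<Sum>r<k. C (cyclic_shift n k r a)) \<le> (\<Sum>a\<in>?A. k * T)" .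
    moreover have "?A \<noteq> {}"
      using k by (auto simp: PiE_eq_empty_iff)
    ultimately obtain a where a: "a \<in> ?A" "(\<Sum>r<k. C (cyclic_shift n k r a)) \<le> k * T"
      using sum_strict_mono[OF finA, of "\<lambda>a. k * T" "\<lambda>a. \<Sum>r<k. C (cyclic_shift n k r a)"]
      by (meson not_less)
    have "?h a f \<in> ?S"
      using a f k by (auto simp: sorted_family_def C_def cyclic_shift_in mix_in_grid)
    thus ?thesis using a by blast
  qed
  have "card ?F \<le> card (\<Union>a\<in>?A. {f \<in> {..<k} \<rightarrow>\<^sub>E grid n. ?h a f \<in> ?S})"
    using finA finF ex by (intro card_mono) auto
  also have "\<dots> \<le> (\<Sum>a\<in>?A. card {f \<in> {..<k} \<rightarrow>\<^sub>E grid n. ?h a f \<in> ?S})"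
    by (rule card_UN_le[OF finA])
  also have "\<dots> \<le> (\<Sum>a\<in>?A. card ?S)"
  proof (rule sum_mono)
    fix a
    have "inj_on (?h a) {f \<in> {..<k} \<rightarrow>\<^sub>E grid n. ?h a f \<in> ?S}"
      by (rule inj_on_subset[OF inj_on_mix_cyclic_shift[OF k]]) auto
    thus "card {f \<in> {..<k} \<rightarrow>\<^sub>E grid n. ?h a f \<in> ?S} \<le> card ?S"
      using finF by (intro card_inj_on_le[of "?h a"]) auto
  qed
  also have "\<dots> = k ^ n * card ?S"
    by (simp add: cardA)
  finally have "card ?F \<le> k ^ n * card ?S" .
  hence "real (card ?F) \<le> real (k ^ n * card ?S)"
    by (rule of_nat_mono)
  also have "\<dots> = real k ^ n * real (card ?S)"
    by simp
  also have "\<dots> \<le> real k ^ n * (4 ^ (n * k) * 2 powr (k * T))"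
    using card_sorted_families_le[of "{..<k}" n t "k * T"] by (intro mult_left_mono) auto
  finally show ?thesis .
qed

section \<open>Uniform distributions on finite families\<close>

text \<open>The pushforward gives repeated inputs their multiplicity, so that expectations are
  averages over \<open>J\<close> even when \<open>\<phi>\<close> is not injective.\<close>

definition empirical :: "nat \<Rightarrow> 'j set \<Rightarrow> ('j \<Rightarrow> input) \<Rightarrow> input measure" where
  "empirical n J \<phi> = distr (uniform_count_measure J) (\<Pi>\<^sub>M i\<in>{..<n}. (borel :: real measure)) \<phi>"

lemma uniform_count_measurable:
  "\<phi> \<in> J \<rightarrow> space N \<Longrightarrow> \<phi> \<in> uniform_count_measure J \<rightarrow>\<^sub>M N"
  by (auto simp: measurable_def space_uniform_count_measure sets_uniform_count_measure)

text \<open>Makes entropy bounds for simple random variables applicable. A fibre is a finite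
  intersection of conditions on ranks, and a rank is a finite sum of indicators of comparisons
  between coordinates.\<close>

lemma rank_perm_simple_function:
  fixes D :: "input measure"
  assumes "sets D = sets (\<Pi>\<^sub>M i\<in>{..<n}. (borel :: real measure))"
  shows "simple_function D (rank_perm n)"
  unfolding simple_function_def
proof (intro conjI ballI)
  let ?R = "{..<n} \<rightarrow>\<^sub>E {..n}"
  have less: "rank_perm n x i \<le> n" if "i < n" for x i
    using that card_mono[of "{..<n}" "{j\<in>{..<n}. x j < x i \<or> (x j = x i \<and> j < i)}"]
    by (auto simp: rank_perm_def)
  have "rank_perm n ` space D \<subseteq> (\<lambda>p i. if i < n then p i else i) ` ?R"
  proof safe
    fix x
    show "rank_perm n x \<in> (\<lambda>p i. if i < n then p i else i) ` ?R"
      using less by (intro image_eqI[of _ _ "restrict (rank_perm n x) {..<n}"])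
        (auto simp: fun_eq_iff rank_perm_def)
  qed
  thus "finite (rank_perm n ` space D)"
    by (rule finite_subset) (simp add: finite_PiE)
  fix p assume "p \<in> rank_perm n ` space D"
  hence p: "p i = i" if "\<not> i < n" for i
    using that by (auto simp: rank_perm_def)
  have meas: "{x \<in> space D. card {j\<in>{..<n}. x j < x i \<or> (x j = x i \<and> j < i)} = p i} \<in> sets D"
    if "i < n" for i
  proof -
    have comp: "(\<lambda>x. x j) \<in> borel_measurable D" if "j < n" for j
      using that measurable_component_singleton[of j "{..<n}" "\<lambda>_. borel"]
        measurable_cong_sets[OF assms refl] by blast
    have "{x \<in> space D. x j < x i \<or> (x j = x i \<and> j < i)} \<in> sets D" if "j < n" for j
      using comp[OF that] comp[OF \<open>i < n\<close>]
      by (intro sets.sets_Collect_disj sets.sets_Collect_conj sets.sets_Collect_const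
          borel_measurable_less borel_measurable_eq)
    hence "(\<lambda>x. if x j < x i \<or> (x j = x i \<and> j < i) then 1 else 0::real) \<in> borel_measurable D"
      if "j < n" for j
      using that by (intro measurable_If) simp_all
    hence "(\<lambda>x. \<Sum>j<n. if x j < x i \<or> (x j = x i \<and> j < i) then 1 else 0::real) \<in> borel_measurable D"
      by (intro borel_measurable_sum) blast
    hence sum: "{x \<in> space D. (\<Sum>j<n. if x j < x i \<or> (x j = x i \<and> j < i) then 1 else 0::real) = real (p i)} \<in> sets D"
      by (rule borel_measurable_eq) simp
    have card: "real (card {j\<in>{..<n}. x j < x i \<or> (x j = x i \<and> j < i)})
        = (\<Sum>j<n. if x j < x i \<or> (x j = x i \<and> j < i) then 1 else 0)" for x :: input
      by (subst sum.If_cases) (simp_all add: Int_def)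
    show ?thesis
      using sum unfolding card[symmetric] of_nat_eq_iff .
  qed
  have "rank_perm n -` {p} \<inter> space D = {x \<in> space D. \<forall>i\<in>{..<n}.
      card {j\<in>{..<n}. x j < x i \<or> (x j = x i \<and> j < i)} = p i}"
    using p by (auto simp: fun_eq_iff rank_perm_def)
  also have "\<dots> \<in> sets D"
    by (intro sets.sets_Collect_finite_All meas) simp_all
  finally show "rank_perm n -` {p} \<inter> space D \<in> sets D" .
qed

context
  fixes n :: nat and J :: "'j set" and \<phi> :: "'j \<Rightarrow> input"
  assumes J: "finite J" "J \<noteq> {}" and \<phi>: "\<phi> \<in> J \<rightarrow> extensional {..<n}"
begin

lemma empirical_map_measurable:
  "\<phi> \<in> uniform_count_measure J \<rightarrow>\<^sub>M (\<Pi>\<^sub>M i\<in>{..<n}. (borel :: real measure))"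
  using \<phi> by (intro uniform_count_measurable) (auto simp: space_PiM PiE_def)

lemma empirical_in_input_dists: "empirical n J \<phi> \<in> input_dists n"
  using prob_space.prob_space_distr[OF prob_space_uniform_count_measure[OF J] empirical_map_measurable]
  by (simp add: input_dists_def empirical_def)

text \<open>Pulled back along \<open>\<phi>\<close>, the property holds almost everywhere for a
  measure that gives every index positive mass, so no index is exceptional.\<close>

lemma AE_empiricalD: "AE x in empirical n J \<phi>. P x \<Longrightarrow> \<forall>j\<in>J. P (\<phi> j)"
proof -
  assume "AE x in empirical n J \<phi>. P x"
  hence "AE j in uniform_count_measure J. P (\<phi> j)"
    unfolding empirical_def by (rule AE_distrD[OF empirical_map_measurable])
  hence "\<forall>j\<in>J. 0 < ennreal (1 / card J) \<longrightarrow> P (\<phi> j)"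
    unfolding uniform_count_measure_def AE_point_measure .
  moreover have "0 < ennreal (1 / card J)"
    using J by (simp add: card_gt_0_iff)
  ultimately show ?thesis by blast
qed

text \<open>\<open>G\<close> need not be measurable, so \<open>nn_integral_distr\<close> applies only to its restriction to
  the finite support.\<close>

lemma sum_le_nn_integral_empirical:
  fixes G :: "input \<Rightarrow> ennreal"
  shows "(\<Sum>j\<in>J. ennreal (1 / card J) * G (\<phi> j)) \<le> (\<integral>\<^sup>+ x. G x \<partial>empirical n J \<phi>)"
proof -
  let ?P = "\<Pi>\<^sub>M i\<in>{..<n}. (borel :: real measure)"
  \<comment> \<open>The sum runs over the image of \<open>J\<close>, so a repeated input is counted
    once and \<open>?h\<close> agrees with \<open>G\<close> there.\<close>
  let ?h = "\<lambda>x. \<Sum>y\<in>\<phi> ` J. G y * indicator {y} x"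
  have sing: "{y} \<in> sets ?P" if "y \<in> \<phi> ` J" for y
  proof -
    have "{y} = (\<Pi>\<^sub>E i\<in>{..<n}. {y i})"
      using that \<phi> by (intro PiE_singleton[symmetric]) auto
    thus ?thesis
      by (metis (no_types, lifting) borel_singleton finite_lessThan sets.empty_sets sets_PiM_I_finite)
  qed
  have h: "?h x = (if x \<in> \<phi> ` J then G x else 0)" for x
    using J by (simp add: indicator_def if_distrib[of "(*) _"] cong: if_cong)
  have meas: "?h \<in> borel_measurable ?P"
    using sing by (intro borel_measurable_sum borel_measurable_times borel_measurable_indicator) auto
  have "(\<Sum>j\<in>J. ennreal (1 / card J) * G (\<phi> j)) = (\<integral>\<^sup>+ j. ?h (\<phi> j) \<partial>uniform_count_measure J)"
    unfolding h uniform_count_measure_def by (subst nn_integral_point_measure_finite[OF J(1)]) simp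
  also have "\<dots> = (\<integral>\<^sup>+ x. ?h x \<partial>empirical n J \<phi>)"
    unfolding empirical_def using meas
    by (intro nn_integral_distr[symmetric] empirical_map_measurable) simp
  also have "\<dots> \<le> (\<integral>\<^sup>+ x. G x \<partial>empirical n J \<phi>)"
    unfolding h by (intro nn_integral_mono) auto
  finally show ?thesis .
qed

text \<open>Entropy is at most the logarithm of the number of values of positive probability. On the
  whole space \<open>rank_perm\<close> may take many more values, but only those attained on the
  family have positive probability.\<close>

lemma perm_entropy_empirical_le: "perm_entropy n (empirical n J \<phi>) \<le> log 2 (card J)"
proof -
  let ?D = "empirical n J \<phi>"
  have D: "prob_space ?D" "sets ?D = sets (\<Pi>\<^sub>M i\<in>{..<n}. (borel :: real measure))"
    using empirical_in_input_dists by (auto simp: input_dists_def)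
  interpret prob_space ?D by (rule D)
  interpret information_space ?D 2 by standard simp
  let ?f = "\<lambda>p. prob (rank_perm n -` {p} \<inter> space ?D)"
  note sf = rank_perm_simple_function[OF D(2)]
  have sd: "simple_distributed ?D (rank_perm n) ?f"
    by (rule simple_distributedI[OF sf]) (auto simp: measure_nonneg)
  let ?S = "rank_perm n ` space ?D \<inter> {p. ?f p \<noteq> 0}"
  have sub: "?S \<subseteq> (\<lambda>j. rank_perm n (\<phi> j)) ` J"
  proof safe
    fix x assume x: "x \<in> space ?D" "?f (rank_perm n x) \<noteq> 0"
    show "rank_perm n x \<in> (\<lambda>j. rank_perm n (\<phi> j)) ` J"
    proof (rule ccontr)
      assume neg: "\<not> ?thesis"
      let ?X = "rank_perm n -` {rank_perm n x} \<inter> space ?D"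
      have "?X \<in> sets ?D"
        using sf x by (simp add: simple_function_def)
      moreover have "\<phi> -` ?X \<inter> space (uniform_count_measure J) = {}"
        using neg by (force simp: space_uniform_count_measure)
      ultimately have "?f (rank_perm n x) = 0"
        unfolding empirical_def using empirical_map_measurable
        by (subst measure_distr) (auto simp: empirical_def)
      thus False using x by simp
    qed
  qed
  have "card ?S \<le> card J"
    using card_mono[OF _ sub] card_image_le[OF J(1)] J(1) by (meson finite_imageI le_trans)
  moreover have "card J > 0"
    using J by (simp add: card_gt_0_iff)
  \<comment> \<open>\<open>card ?S\<close> is in fact positive, but \<open>log 2 0 = 0\<close> makes this superfluous.\<close>
  ultimately have "log 2 (card ?S) \<le> log 2 (card J)"
    by (cases "card ?S = 0") (simp_all add: log_def divide_right_mono)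
  thus ?thesis
    using entropy_le_card_not_0[OF sd] by (simp add: perm_entropy_def)
qed

text \<open>Passes from the probabilistic guarantee to finite counting: the expected cost is an
  average over \<open>J\<close>, and the entropy is replaced by its upper bound.\<close>

lemma sorts_within_empiricalD:
  assumes "sorts_within n (empirical n J \<phi>) t (c * (real n + perm_entropy n (empirical n J \<phi>)))" "c > 0"
  shows "sorted_family n t J \<phi> (card J * (c * (real n + log 2 (card J))))"
proof -
  let ?T = "c * (real n + log 2 (card J))"
  have cJ: "card J \<ge> 1" using J by (simp add: Suc_leI card_gt_0_iff)
  hence T: "?T \<ge> 0" using \<open>c > 0\<close> by simp
  have "ennreal (\<Sum>j\<in>J. 1 / card J * real (comparisons t (\<phi> j)))
      = (\<Sum>j\<in>J. ennreal (1 / card J) * of_nat (comparisons t (\<phi> j)))"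
    by (simp add: ennreal_of_nat_eq_real_of_nat flip: sum_ennreal ennreal_mult)
  also have "\<dots> \<le> ennreal (c * (real n + perm_entropy n (empirical n J \<phi>)))"
    using sum_le_nn_integral_empirical assms(1) unfolding sorts_within_def by (meson order_trans)
  also have "\<dots> \<le> ennreal ?T"
    using perm_entropy_empirical_le \<open>c > 0\<close> by (intro ennreal_leI) simp
  finally have "(\<Sum>j\<in>J. 1 / card J * real (comparisons t (\<phi> j))) \<le> ?T"
    using T by simp
  hence "(\<Sum>j\<in>J. real (comparisons t (\<phi> j))) \<le> card J * ?T"
    using cJ by (simp add: sum_divide_distrib[symmetric] field_simps)
  moreover have "\<forall>j\<in>J. sorting_perm n (\<phi> j) (result t (\<phi> j))"
    using assms(1) AE_empiricalD unfolding sorts_within_def by blast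
  ultimately show ?thesis
    by (simp add: sorted_family_def)
qed

end

text \<open>A uniform index vector has independent uniform coordinates, so the mixture has
  independent coordinates too. It suffices to compare boxes: the preimage of a box is a box of
  indices, whose relative size factors.\<close>

lemma empirical_mix_in_product_dists:
  assumes k: "0 < k"
  shows "empirical n ({..<n} \<rightarrow>\<^sub>E {..<k}) (mix n f) \<in> product_dists n"
proof -
  define P where "P i = distr (uniform_count_measure {..<k}) (borel :: real measure) (\<lambda>j. f j i)" for i
  let ?A = "{..<n} \<rightarrow>\<^sub>E {..<k}"
  have finA: "finite ?A" and cardA: "card ?A = k ^ n"
    by (auto simp: finite_PiE card_PiE)
  have prob: "prob_space (P i)" for i
    unfolding P_def using k
    by (intro prob_space.prob_space_distr prob_space_uniform_count_measure uniform_count_measurable) auto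
  have setsP: "sets (P i) = sets borel" for i
    by (simp add: P_def)
  have setsPi: "sets (PiM {..<n} P) = sets (\<Pi>\<^sub>M i\<in>{..<n}. (borel :: real measure))"
    by (intro sets_PiM_cong) (auto simp: setsP)
  interpret product_prob_space P "{..<n}"
    by (rule product_prob_spaceI) (rule prob)
  have meas: "mix n f \<in> uniform_count_measure ?A \<rightarrow>\<^sub>M (\<Pi>\<^sub>M i\<in>{..<n}. (borel :: real measure))"
    by (intro uniform_count_measurable) (auto simp: space_PiM mix_def)
  have "empirical n ?A (mix n f) = PiM {..<n} P"
  proof (rule PiM_eqI)
    show "sets (empirical n ?A (mix n f)) = sets (PiM {..<n} P)"
      by (simp add: setsPi empirical_def)
    fix B assume B: "\<And>i. i \<in> {..<n} \<Longrightarrow> B i \<in> sets (P i)"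
    have "emeasure (empirical n ?A (mix n f)) (Pi\<^sub>E {..<n} B)
        = emeasure (uniform_count_measure ?A) (mix n f -` Pi\<^sub>E {..<n} B \<inter> ?A)"
      unfolding empirical_def
    proof (subst emeasure_distr[OF meas])
      show "Pi\<^sub>E {..<n} B \<in> sets (\<Pi>\<^sub>M i\<in>{..<n}. (borel :: real measure))"
        using B by (intro sets_PiM_I_finite) (simp_all add: setsP)
    qed (simp add: space_uniform_count_measure)
    also have "mix n f -` Pi\<^sub>E {..<n} B \<inter> ?A = (\<Pi>\<^sub>E i\<in>{..<n}. {j\<in>{..<k}. f j i \<in> B i})"
      by (rule set_eqI) (simp add: mix_def PiE_iff, blast)
    also have "emeasure (uniform_count_measure ?A) \<dots>
        = ennreal (card (\<Pi>\<^sub>E i\<in>{..<n}. {j\<in>{..<k}. f j i \<in> B i}) / card ?A)"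
      by (rule emeasure_uniform_count_measure[OF finA]) (simp add: subset_iff PiE_iff)
    also have "\<dots> = ennreal (\<Prod>i<n. card {j\<in>{..<k}. f j i \<in> B i} / k)"
      by (simp add: card_PiE prod_dividef)
    also have "\<dots> = (\<Prod>i<n. ennreal (card {j\<in>{..<k}. f j i \<in> B i} / k))"
      by (rule prod_ennreal[symmetric]) simp
    also have "\<dots> = (\<Prod>i<n. emeasure (P i) (B i))"
    proof (rule prod.cong)
      fix i assume "i \<in> {..<n}"
      hence "emeasure (P i) (B i) = emeasure (uniform_count_measure {..<k}) ((\<lambda>j. f j i) -` B i \<inter> {..<k})"
        unfolding P_def using B setsP
        by (subst emeasure_distr) (auto intro!: uniform_count_measurable simp: space_uniform_count_measure)
      also have "(\<lambda>j. f j i) -` B i \<inter> {..<k} = {j\<in>{..<k}. f j i \<in> B i}"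
        by auto
      also have "emeasure (uniform_count_measure {..<k}) \<dots> = ennreal (card {j\<in>{..<k}. f j i \<in> B i} / k)"
        by (subst emeasure_uniform_count_measure) auto
      finally show "ennreal (card {j\<in>{..<k}. f j i \<in> B i} / k) = emeasure (P i) (B i)" ..
    qed simp
    finally show "emeasure (empirical n ?A (mix n f)) (Pi\<^sub>E {..<n} B) = (\<Prod>i<n. emeasure (P i) (B i))" .
  qed simp
  thus ?thesis
    unfolding product_dists_def using prob setsP by blast
qed

section \<open>Counting stored bit strings\<close>

lemma card_bool_lists_less_le: "card {b :: bool list. length b < N} \<le> 2 ^ N"
proof (cases N)
  case (Suc M)
  have "card {b :: bool list. length b < N} = (\<Sum>i\<le>M. 2 ^ i)"
    using card_lists_length_le[of "UNIV :: bool set" M] by (simp add: Suc less_Suc_eq_le)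
  also have "\<dots> = (\<Sum>i<N. 2 ^ i)"
    by (simp add: Suc lessThan_Suc_atMost)
  also have "\<dots> \<le> 2 ^ N"
    by (simp add: sum_power2 flip: atLeast0LessThan)
  finally show ?thesis .
qed simp

text \<open>Pigeonhole: the tree depends only on the stored string, and one tree serves at most
  \<open>B\<close> members of \<open>F\<close>. The 1 in the exponent pays for rounding
  \<open>s\<close> up to an integer.\<close>

lemma card_le_if_not_requires_storage:
  fixes D :: "'f \<Rightarrow> input measure"
  assumes "finite F" "\<And>f. f \<in> F \<Longrightarrow> D f \<in> \<D> n"
    and ok: "\<And>f. f \<in> F \<Longrightarrow> ok (tree_of A n (stored A n (D f))) f"
    and B: "\<And>t. real (card {f \<in> F. ok t f}) \<le> B"
    and s: "\<not> requires_storage A \<D> n s" "0 \<le> s"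
  shows "real (card F) \<le> 2 powr (s + 1) * B"
proof -
  define N where "N = nat \<lceil>s\<rceil>"
  let ?L = "{b :: bool list. length b < N}"
  have finL: "finite ?L"
    by (rule finite_subset[OF _ finite_lists_length_le[of UNIV N]]) auto
  have "B \<ge> 0"
    using B[of undefined] by (meson of_nat_0_le_iff order_trans)
  have "length (stored A n (D f)) < N" if "f \<in> F" for f
  proof -
    have "real (length (stored A n (D f))) < s"
      using s(1) assms(2)[OF that] unfolding requires_storage_def by force
    also have "s \<le> real N"
      by (simp add: N_def real_nat_ceiling_ge)
    finally show ?thesis by simp
  qed
  hence "F \<subseteq> (\<Union>b\<in>?L. {f \<in> F. ok (tree_of A n b) f})"
    using ok by blast
  hence "card F \<le> card (\<Union>b\<in>?L. {f \<in> F. ok (tree_of A n b) f})"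
    using assms(1) finL by (intro card_mono) auto
  also have "\<dots> \<le> (\<Sum>b\<in>?L. card {f \<in> F. ok (tree_of A n b) f})"
    by (rule card_UN_le[OF finL])
  finally have "real (card F) \<le> real (\<Sum>b\<in>?L. card {f \<in> F. ok (tree_of A n b) f})"
    by (rule of_nat_mono)
  also have "\<dots> = (\<Sum>b\<in>?L. real (card {f \<in> F. ok (tree_of A n b) f}))"
    by simp
  also have "\<dots> \<le> (\<Sum>b\<in>?L. B)"
    by (intro sum_mono B)
  also have "\<dots> = real (card ?L) * B"
    by simp
  also have "\<dots> \<le> 2 powr (s + 1) * B"
  proof (rule mult_right_mono[OF _ \<open>B \<ge> 0\<close>])
    have "real (card ?L) \<le> real (2 ^ N)"
      by (rule of_nat_mono[OF card_bool_lists_less_le])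
    also have "\<dots> = 2 powr real N"
      by (simp add: powr_realpow)
    also have "real N \<le> s + 1"
      using \<open>0 \<le> s\<close> unfolding N_def by linarith
    finally show "real (card ?L) \<le> 2 powr (s + 1)"
      by simp
  qed
  finally show ?thesis .
qed

section \<open>Comparison of exponents\<close>

lemma log2_ceiling_powr_le:
  assumes "0 \<le> x"
  shows "log 2 (real (nat \<lceil>2 powr x\<rceil>)) \<le> x + 1"
proof -
  define r where "r = real (nat \<lceil>2 powr x\<rceil>)"
  have "1 \<le> 2 powr x"
    using assms by (simp add: ge_one_powr_ge_zero)
  moreover have "2 powr (x + 1) = 2 * 2 powr x"
    by (simp add: powr_add)
  ultimately have "0 < r" "r \<le> 2 powr (x + 1)"
    unfolding r_def by linarith+
  thus ?thesis
    by (simp add: log_le_iff flip: r_def)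
qed

lemma power_eq_2_powr: "0 < (r :: real) \<Longrightarrow> r ^ k = 2 powr (real k * log 2 r)"
  by (simp flip: log_nat_power)

lemma four_power_eq_2_powr: "(4 :: real) ^ k = 2 powr (2 * real k)"
  using powr_realpow[of 2 "2 * k"] by (simp add: power_mult)

lemma card_grid_families:
  assumes "0 < n"
  shows "real (card ({..<m} \<rightarrow>\<^sub>E grid n)) = 2 powr (real n * real m * log 2 (real n))"
  using assms power_eq_2_powr[of "real n" "n * m"] by (simp add: card_PiE card_grid power_mult)

lemma eventually_log2_gt: "\<forall>\<^sub>F n in sequentially. C < log 2 (real n)"
  by real_asymp

text \<open>Both sides of the pigeonhole count are powers of 2. Comparing exponents and dividing by
  \<open>m\<close> leaves \<open>n * log 2 n\<close> against \<open>T\<close> plus terms linear in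
  \<open>n\<close>, so too little storage is possible only for small \<open>n\<close>.\<close>

lemma input_dists_storage:
  assumes A: "self_improving_sorter A input_dists c" and c: "0 < c" and n: "1 \<le> n"
    and less: "\<not> requires_storage A input_dists n (2 powr (1 / (2 * c) * (real n * log 2 (real n))))"
  shows "log 2 (real n) \<le> 8 + 4 * c"
proof -
  define L where "L = log 2 (real n)"
  \<comment> \<open>The constant \<open>1 / (2 * c)\<close> makes \<open>c * x\<close> half of
    \<open>n * L\<close>, so the entropy part of the time bound leaves the other half.\<close>
  define x where "x = 1 / (2 * c) * (real n * L)"
  \<comment> \<open>As \<open>2 powr x \<le> m\<close>, the assumed storage is at most one bit per
    member of the family.\<close>
  define m where "m = nat \<lceil>2 powr x\<rceil>"
  define T where "T = c * (real n + log 2 (real m))"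
  have "0 \<le> L" using n by (simp add: L_def)
  hence x: "0 \<le> x" using c by (simp add: x_def)
  have m: "2 powr x \<le> real m"
    by (simp add: m_def real_nat_ceiling_ge)
  moreover have "1 \<le> 2 powr x"
    using x by (simp add: ge_one_powr_ge_zero)
  ultimately have m1: "1 \<le> real m" by linarith
  have logm: "log 2 (real m) \<le> x + 1"
    unfolding m_def by (rule log2_ceiling_powr_le[OF x])
  let ?F = "{..<m} \<rightarrow>\<^sub>E grid n"
  have mne: "{..<m} \<noteq> {}" using m1 by (auto simp: lessThan_empty_iff)
  have ext: "f \<in> {..<m} \<rightarrow> extensional {..<n}" if "f \<in> ?F" for f
    using that by (force simp: grid_def PiE_def)
  have "real (card ?F) \<le> 2 powr (2 powr x + 1) * (4 ^ (n * m) * 2 powr (real m * T))"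
  proof (rule card_le_if_not_requires_storage[where D = "empirical n {..<m}" and \<D> = input_dists
        and n = n and A = A and ok = "\<lambda>t f. sorted_family n t {..<m} f (real m * T)"])
    show "finite ?F" by (simp add: finite_PiE)
    fix f assume f: "f \<in> ?F"
    show D: "empirical n {..<m} f \<in> input_dists n"
      by (rule empirical_in_input_dists) (use mne ext[OF f] in auto)
    show "sorted_family n (tree_of A n (stored A n (empirical n {..<m} f))) {..<m} f (real m * T)"
      using sorts_within_empiricalD[OF _ mne ext[OF f], where c = c] A n D c
      by (simp add: self_improving_sorter_def T_def)
  next
    show "real (card {f \<in> ?F. sorted_family n t {..<m} f (real m * T)})
        \<le> 4 ^ (n * m) * 2 powr (real m * T)" for t
      using card_sorted_families_le[of "{..<m}"] by simp
  qed (use less in \<open>simp_all add: x_def L_def\<close>)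
  also have "real (card ?F) = 2 powr (real n * real m * L)"
    unfolding L_def by (rule card_grid_families) (use n in simp)
  also have "2 powr (2 powr x + 1) * (4 ^ (n * m) * 2 powr (real m * T))
      = 2 powr (2 powr x + 1 + 2 * (real n * real m) + real m * T)"
    by (simp add: four_power_eq_2_powr powr_add)
  finally have "real n * real m * L \<le> 2 powr x + 1 + 2 * (real n * real m) + real m * T"
    by simp
  also have "\<dots> \<le> real m + real m + real m * (2 * real n) + real m * T"
    using m m1 by (simp add: algebra_simps)
  finally have "real m * (real n * L) \<le> real m * (2 + 2 * real n + T)"
    by (simp add: algebra_simps)
  hence "real n * L \<le> 2 + 2 * real n + T"
    using m1 by simp
  also have "T \<le> c * (real n + (x + 1))"
    unfolding T_def using logm c by (intro mult_left_mono) auto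
  also have "\<dots> = c * real n + c + real n * L / 2"
    using c by (simp add: x_def field_simps)
  finally have "real n * L \<le> 4 + 4 * real n + 2 * c * real n + 2 * c"
    by simp
  also have "\<dots> \<le> real n * (8 + 4 * c)"
    using mult_right_mono[of 1 "real n" "4 + 2 * c"] n c by (simp add: algebra_simps)
  finally show ?thesis
    using n by (simp add: L_def)
qed

lemma product_dists_storage:
  assumes A: "self_improving_sorter A product_dists (1 / \<epsilon>)" and \<epsilon>: "0 < \<epsilon>" "\<epsilon> < 1" and n: "1 \<le> n"
    and less: "\<not> requires_storage A product_dists n (real n powr (1 + 1 / 4 * \<epsilon>))"
  shows "3 / 4 * log 2 (real n) \<le> 5 + 2 / \<epsilon>"
proof -
  define L where "L = log 2 (real n)"
  \<comment> \<open>With \<open>k\<close> about \<open>n powr (\<epsilon> / 4)\<close>, the entropy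
    contributes \<open>n * x / \<epsilon>\<close>, a quarter of \<open>n * L\<close>, to the time
    bound; three quarters remain.\<close>
  define x where "x = \<epsilon> / 4 * L"
  define k where "k = nat \<lceil>2 powr x\<rceil>"
  define T where "T = 1 / \<epsilon> * (real n + log 2 (real (k ^ n)))"
  have "0 \<le> L" using n by (simp add: L_def)
  hence x: "0 \<le> x" using \<epsilon> by (simp add: x_def)
  have k: "2 powr x \<le> real k"
    by (simp add: k_def real_nat_ceiling_ge)
  moreover have "1 \<le> 2 powr x"
    using x by (simp add: ge_one_powr_ge_zero)
  ultimately have k1: "1 \<le> real k" by linarith
  hence k0: "0 < k" by simp
  have logk: "log 2 (real k) \<le> x + 1"
    unfolding k_def by (rule log2_ceiling_powr_le[OF x])
  have npow: "real n = 2 powr L"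
    using n by (simp add: L_def)
  \<comment> \<open>As \<open>2 powr x \<le> k\<close>, the assumed storage is at most
    \<open>n\<close> bits per row, against \<open>n * L\<close> bits of information in a
    row.\<close>
  have s: "real n powr (1 + 1 / 4 * \<epsilon>) = real n * 2 powr x"
    using n by (simp add: powr_add x_def npow powr_powr mult.commute)
  let ?F = "{..<k} \<rightarrow>\<^sub>E grid n" and ?A = "{..<n} \<rightarrow>\<^sub>E {..<k}"
  have finA: "finite ?A" and cardA: "card ?A = k ^ n" and Ane: "?A \<noteq> {}"
    using k0 by (auto simp: finite_PiE card_PiE PiE_eq_empty_iff)
  have ext: "mix n f \<in> ?A \<rightarrow> extensional {..<n}" for f
    by (auto simp: mix_def)
  have "real (card ?F) \<le> 2 powr (real n * 2 powr x + 1) * (real k ^ n * (4 ^ (n * k) * 2 powr (real k * T)))"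
  proof (rule card_le_if_not_requires_storage[where D = "\<lambda>f. empirical n ?A (mix n f)"
        and \<D> = product_dists and n = n and A = A
        and ok = "\<lambda>t f. sorted_family n t ?A (mix n f) (real k ^ n * T)"])
    show "finite ?F" by (simp add: finite_PiE)
    fix f
    show D: "empirical n ?A (mix n f) \<in> product_dists n"
      by (rule empirical_mix_in_product_dists[OF k0])
    show "sorted_family n (tree_of A n (stored A n (empirical n ?A (mix n f)))) ?A (mix n f) (real k ^ n * T)"
      using sorts_within_empiricalD[OF finA Ane ext, where c = "1 / \<epsilon>"] A n D \<epsilon>
      by (simp add: self_improving_sorter_def T_def cardA)
  next
    show "real (card {f \<in> ?F. sorted_family n t ?A (mix n f) (real k ^ n * T)})
        \<le> real k ^ n * (4 ^ (n * k) * 2 powr (real k * T))" for t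
      by (rule card_sorted_mixtures_le[OF k0])
  qed (use less[unfolded s] in simp_all)
  also have "real (card ?F) = 2 powr (real n * real k * L)"
    unfolding L_def by (rule card_grid_families) (use n in simp)
  also have "2 powr (real n * 2 powr x + 1) * (real k ^ n * (4 ^ (n * k) * 2 powr (real k * T)))
      = 2 powr (real n * 2 powr x + 1 + real n * log 2 (real k) + 2 * (real n * real k) + real k * T)"
    unfolding four_power_eq_2_powr power_eq_2_powr[OF less_le_trans[OF zero_less_one k1]] powr_add
    by simp
  finally have "real n * real k * L
      \<le> real n * 2 powr x + 1 + real n * log 2 (real k) + 2 * (real n * real k) + real k * T"
    by simp
  \<comment> \<open>Here \<open>log 2 k \<le> k\<close> absorbs the factor \<open>k ^ n\<close> lost
    in choosing a class of shifts.\<close>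
  also have "\<dots> \<le> real n * real k + real n * real k + real n * real k + 2 * (real n * real k) + real k * T"
  proof (intro add_mono mult_left_mono order_refl k)
    show "1 \<le> real n * real k"
      using n k1 by (simp add: mult_ge1_I)
    have "real k \<le> real (2 ^ k)"
      by (rule of_nat_mono) (rule less_imp_le[OF less_exp])
    thus "log 2 (real k) \<le> real k"
      using k0 by (simp add: log_le_iff powr_realpow)
  qed simp_all
  finally have "real k * (real n * L) \<le> real k * (5 * real n + T)"
    by (simp add: algebra_simps)
  hence "real n * L \<le> 5 * real n + T"
    using k1 by simp
  also have "T = 1 / \<epsilon> * (real n + real n * log 2 (real k))"
    using k0 by (simp add: T_def log_nat_power)
  also have "\<dots> \<le> 1 / \<epsilon> * (real n + real n * (x + 1))"
    using logk \<epsilon> by (intro mult_left_mono add_left_mono) auto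
  also have "\<dots> = real n * (2 / \<epsilon> + L / 4)"
    using \<epsilon> by (simp add: x_def field_simps)
  finally have "real n * L \<le> real n * (5 + 2 / \<epsilon> + L / 4)"
    by (simp add: algebra_simps)
  hence "L \<le> 5 + 2 / \<epsilon> + L / 4"
    using n by simp
  thus ?thesis
    by (simp add: L_def)
qed

theorem theorem1p2:
  shows "(\<forall>c>0. \<exists>\<delta>>0. \<forall>A. self_improving_sorter A input_dists c \<longrightarrow>
            (\<forall>\<^sub>F n in sequentially.
               requires_storage A input_dists n (2 powr (\<delta> * (real n * log 2 (real n))))))
       \<and> (\<exists>\<delta>>0. \<forall>\<epsilon>. 0 < \<epsilon> \<and> \<epsilon> < 1 \<longrightarrow>
            (\<forall>A. self_improving_sorter A product_dists (1 / \<epsilon>) \<longrightarrow>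
               (\<forall>\<^sub>F n in sequentially.
                  requires_storage A product_dists n (real n powr (1 + \<delta> * \<epsilon>)))))"
proof (intro conjI allI impI)
  fix c :: real assume c: "0 < c"
  have "\<forall>\<^sub>F n in sequentially. requires_storage A input_dists n
          (2 powr (1 / (2 * c) * (real n * log 2 (real n))))"
    if "self_improving_sorter A input_dists c" for A
    \<comment> \<open>Beyond this threshold, which depends on \<open>c\<close> only, insufficient
      storage contradicts \<open>input_dists_storage\<close>.\<close>
    using eventually_log2_gt[of "8 + 4 * c"] eventually_ge_at_top[of 1]
    by eventually_elim (use input_dists_storage[OF that c] in force)
  thus "\<exists>\<delta>>0. \<forall>A. self_improving_sorter A input_dists c \<longrightarrow>
      (\<forall>\<^sub>F n in sequentially.
         requires_storage A input_dists n (2 powr (\<delta> * (real n * log 2 (real n)))))"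
    using c by (intro exI[of _ "1 / (2 * c)"]) auto
next
  have "\<forall>\<^sub>F n in sequentially. requires_storage A product_dists n (real n powr (1 + 1 / 4 * \<epsilon>))"
    if "0 < \<epsilon>" "\<epsilon> < 1" "self_improving_sorter A product_dists (1 / \<epsilon>)" for A and \<epsilon> :: real
    \<comment> \<open>The threshold for \<open>n\<close> grows as \<open>\<epsilon>\<close> tends to
      0, while the constant \<open>1 / 4\<close> is the same for all
      \<open>\<epsilon>\<close>.\<close>
    using eventually_log2_gt[of "4 / 3 * (5 + 2 / \<epsilon>)"] eventually_ge_at_top[of 1]
    by eventually_elim (use product_dists_storage[OF that(3,1,2)] in force)
  thus "\<exists>\<delta>>0. \<forall>\<epsilon>. 0 < \<epsilon> \<and> \<epsilon> < 1 \<longrightarrow>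
      (\<forall>A. self_improving_sorter A product_dists (1 / \<epsilon>) \<longrightarrow>
         (\<forall>\<^sub>F n in sequentially. requires_storage A product_dists n (real n powr (1 + \<delta> * \<epsilon>))))"
    by (intro exI[of _ "1 / 4"]) auto
qed

end
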